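(* There is a constant $C>0$ not depending on $N$ such that the following holds for every odd integer $N\ge1$. Let $\sigma_a,\sigma_s$ be given (known) admissible absorption and scattering coefficients and $f\in H^{5/2}(\partial\Omega)$ a given boundary source, and let $\Phi$ be the solution of the (simplified-coefficient) $SP_N$ system with coefficients $(\sigma_a,\sigma_s)$ and source $f$. Let $\Upsilon_1,\Upsilon_2$ be two admissible Grüneisen coefficients and $H_i=\Upsilon_i\sigma_a(\mathbf s_1\cdot\Phi)$, $i=1,2$, the corresponding internal data. Then $$\Big\|(\Upsilon_1-\Upsilon_2)\frac{H_1}{\Upsilon_1}\Big\|_{L^2(\Omega)}\le C\,\Big\|\frac{H_1-H_2}{\sigma_a}\Big\|_{L^2(\Omega)}.$$
   Context: Standing assumptions. $\Omega\subset\mathbb R^3$ is a bounded, simply connected domain with $C^{2,1}$ boundary and outward unit normal $\mathbf n$. Fix $g\in(-1,1)$ and constants $0<\underline c\le\overline c<\infty$, $M_0<\infty$ (constants may depend on these). Admissible coefficients $(\sigma_a,\sigma_s,\Upsilon)$ satisfy $\underline c\le\sigma_a,\sigma_s,\Upsilon\le\overline c$, $\sigma_a,\sigma_s\in C^{1,1}(\overline\Omega)$ with $\|\sigma_a\|_{C^{1,1}},\|\sigma_s\|_{C^{1,1}}\le M_0$, and the values of $\sigma_a,\sigma_s$ on $\partial\Omega$ are known. Matrices (size $m\times m$, $m=(N+1)/2$, $N$ odd). $M$ is upper bidiagonal with $M_{n,n}=2n-1$, $M_{n,n+1}=2n$, all other entries $0$. $\mathbf s_k=[s_{k,1},\dots,s_{k,m}]$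 denotes the $k$-th row of $M^{-1}$. $L=\mathrm{diag}(1/(4n-3))_{n=1}^{m}$. $P_l$ is the Legendre polynomial of degree $l$ with $P_l(1)=1$; $R_{ij}=(4j-3)\int_0^1P_{2i-1}(x)P_{2j-2}(x)\,dx$; $k_{2n-1}=\int_0^1P_{2n-1}(x)\,dx$. Simplified coefficients: $\sigma_0:=\sigma_a$ and $\sigma_n:=(1-g^n)\sigma_s$ for $n\ge1$. $\Sigma_e=\mathrm{diag}(\sigma_0,\sigma_2,\dots,\sigma_{N-1})$. $SP_N$ system: $\Phi=[\varphi_1,\dots,\varphi_m]^T$ is the (unique) weak solution in $[H^1(\Omega)]^m$ of $-\nabla\cdot(LM^TD\nabla\Phi)+\Sigma_eM^{-1}\Phi=0$ in $\Omega$, $RM^{-1}\Phi+D\,\partial\Phi/\partial\mathbf n=\mathbf k f$ on $\partial\Omega$, with $D=\mathrm{diag}\big(1/((4n-1)\sigma_{2n-1})\big)_{n=1}^m$, $\mathbf k f=(k_{2n-1}f)_{n=1}^m$; that is, for all $\Psi=[\psi_1,\dots,\psi_m]^T\in[H^1(\Omega)]^m$, $$\sum_{n=1}^m\int_\Omega\frac{\nabla\varphi_n\cdot\nabla\psi_n}{(4n-1)\sigma_{2n-1}}d\mathbf x+\int_\Omega\langle M^{-T}L^{-1}\Sigma_eM^{-1}\Phi,\Psi\rangle d\mathbf x+\int_{\partial\Omega}\langle RM^{-1}\Phi,\Psi\rangle ds=\sum_{n=1}^mk_{2n-1}\int_{\partial\Omega}f\psi_n\,ds.$$ The internal datum is $H=\Upsilon\sigma_a\,(\mathbf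 s_1\cdot\Phi)$. *)

theory Defs
  imports
    "HOL-Analysis.Analysis"
    "HOL-Computational_Algebra.Polynomial"
    "Jordan_Normal_Form.Gauss_Jordan_Elimination"
begin

section \<open>Classical differentiability\<close>

text \<open>Partial derivative in the direction of a basis vector \<open>i\<close>; meaningful where \<open>f\<close> is
  differentiable.\<close>

definition pd :: "'a::euclidean_space \<Rightarrow> ('a \<Rightarrow> real) \<Rightarrow> 'a \<Rightarrow> real" where
  "pd i f x = frechet_derivative f (at x) i"

definition grad :: "('a::euclidean_space \<Rightarrow> real) \<Rightarrow> 'a \<Rightarrow> 'a" where
  "grad f x = (\<Sum>i\<in>Basis. pd i f x *\<^sub>R i)"

text \<open>\<open>C\<^sup>k(U)\<close> and \<open>C\<^sup>k\<^sup>,\<^sup>1(U)\<close> for open \<open>U\<close>. In the latter only the derivatives of order \<open>k\<close> are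
  explicitly Lipschitz; it is used on balls only, where this implies that all lower order
  derivatives are bounded and Lipschitz as well.\<close>

primrec Ck_on :: "nat \<Rightarrow> 'a::euclidean_space set \<Rightarrow> ('a \<Rightarrow> real) \<Rightarrow> bool" where
  "Ck_on 0 U f \<longleftrightarrow> continuous_on U f"
| "Ck_on (Suc k) U f \<longleftrightarrow> (\<forall>x\<in>U. f differentiable at x) \<and> (\<forall>i\<in>Basis. Ck_on k U (pd i f))"

primrec CkLip_on :: "nat \<Rightarrow> 'a::euclidean_space set \<Rightarrow> ('a \<Rightarrow> real) \<Rightarrow> bool" where
  "CkLip_on 0 U f \<longleftrightarrow> (\<exists>K. K-lipschitz_on U f)"
| "CkLip_on (Suc k) U f \<longleftrightarrow> (\<forall>x\<in>U. f differentiable at x) \<and> (\<forall>i\<in>Basis. CkLip_on k U (pd i f))"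

definition smooth :: "('a::euclidean_space \<Rightarrow> real) \<Rightarrow> bool" where
  "smooth f \<longleftrightarrow> (\<forall>k. Ck_on k UNIV f)"

definition test_functions :: "'a::euclidean_space set \<Rightarrow> ('a \<Rightarrow> real) set" where
  "test_functions U = {\<eta>. smooth \<eta> \<and> compact (closure {x. \<eta> x \<noteq> 0}) \<and> closure {x. \<eta> x \<noteq> 0} \<subseteq> U}"

text \<open>The space \<open>C\<^sup>1\<^sup>,\<^sup>1\<close> of the closure of the open set \<open>U\<close>, with its norm (value \<open>\<infinity>\<close> allowed).
  Lipschitz continuity of the first derivatives on \<open>U\<close> makes them extend continuously to the
  closure. The quotient below is \<open>0\<close> for \<open>x = y\<close>.\<close>

definition C11_norm :: "'a::euclidean_space set \<Rightarrow> ('a \<Rightarrow> real) \<Rightarrow> ennreal" where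
  "C11_norm U u =
     (SUP x\<in>U. ennreal \<bar>u x\<bar>)
     + (\<Sum>i\<in>Basis. SUP x\<in>U. ennreal \<bar>pd i u x\<bar>)
     + (\<Sum>i\<in>Basis. SUP (x, y)\<in>U \<times> U. ennreal (\<bar>pd i u x - pd i u y\<bar> / dist x y))"

definition C11_closure :: "'a::euclidean_space set \<Rightarrow> ('a \<Rightarrow> real) \<Rightarrow> bool" where
  "C11_closure U u \<longleftrightarrow>
     continuous_on (closure U) u \<and> (\<forall>x\<in>U. u differentiable at x) \<and> C11_norm U u < \<infinity>"

section \<open>Square-integrable functions and Sobolev spaces\<close>

text \<open>Elements of \<open>L\<^sup>2\<close> and of the Sobolev spaces are represented by functions rather than by
  classes of almost everywhere equal functions.\<close>

definition L2 :: "'a measure \<Rightarrow> ('a \<Rightarrow> real) set" where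
  "L2 M = {u. u \<in> borel_measurable M \<and> integrable M (\<lambda>x. (u x)\<^sup>2)}"

definition L2_norm :: "'a measure \<Rightarrow> ('a \<Rightarrow> real) \<Rightarrow> real" where
  "L2_norm M u = sqrt (\<integral>x. (u x)\<^sup>2 \<partial>M)"

definition weak_pd :: "'a::euclidean_space set \<Rightarrow> 'a \<Rightarrow> ('a \<Rightarrow> real) \<Rightarrow> ('a \<Rightarrow> real) \<Rightarrow> bool" where
  "weak_pd U i u v \<longleftrightarrow>
     (\<forall>\<eta>\<in>test_functions U.
        (\<integral>x. u x * pd i \<eta> x \<partial>lebesgue_on U) = - (\<integral>x. v x * \<eta> x \<partial>lebesgue_on U))"

definition is_weak_grad :: "'a::euclidean_space set \<Rightarrow> ('a \<Rightarrow> real) \<Rightarrow> ('a \<Rightarrow> 'a) \<Rightarrow> bool" where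
  "is_weak_grad U u G \<longleftrightarrow>
     (\<forall>i\<in>Basis. (\<lambda>x. inner (G x) i) \<in> L2 (lebesgue_on U) \<and> weak_pd U i u (\<lambda>x. inner (G x) i))"

definition Sobolev_H1 :: "'a::euclidean_space set \<Rightarrow> ('a \<Rightarrow> real) set" where
  "Sobolev_H1 U = {u \<in> L2 (lebesgue_on U). \<exists>G. is_weak_grad U u G}"

text \<open>The weak gradient of an \<open>H\<^sup>1\<close> function, determined up to a null set.\<close>

definition wgrad :: "'a::euclidean_space set \<Rightarrow> ('a \<Rightarrow> real) \<Rightarrow> 'a \<Rightarrow> 'a" where
  "wgrad U u = (SOME G. is_weak_grad U u G)"

text \<open>Sobolev--Slobodeckij space \<open>H\<^sup>k\<^sup>+\<^sup>\<theta>(U)\<close>, \<open>0 < \<theta> < 1\<close>: all weak derivatives up to order \<open>k\<close>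
  are square-integrable and those of order \<open>k\<close> have finite Gagliardo seminorm (the recursion
  descends one derivative at a time).\<close>

definition gagliardo :: "real \<Rightarrow> 'a::euclidean_space set \<Rightarrow> ('a \<Rightarrow> real) \<Rightarrow> ennreal" where
  "gagliardo \<theta> U u =
     (\<integral>\<^sup>+x. \<integral>\<^sup>+y. ennreal ((u x - u y)\<^sup>2 / dist x y powr (real DIM('a) + 2 * \<theta>))
        \<partial>lebesgue_on U \<partial>lebesgue_on U)"

primrec H_frac :: "real \<Rightarrow> nat \<Rightarrow> 'a::euclidean_space set \<Rightarrow> ('a \<Rightarrow> real) \<Rightarrow> bool" where
  "H_frac \<theta> 0 U u \<longleftrightarrow> u \<in> L2 (lebesgue_on U) \<and> gagliardo \<theta> U u < \<infinity>"
| "H_frac \<theta> (Suc k) U u \<longleftrightarrow>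
     u \<in> L2 (lebesgue_on U) \<and> (\<forall>i\<in>Basis. \<exists>v. weak_pd U i u v \<and> H_frac \<theta> k U v)"

section \<open>Boundary regularity, surface measure, traces\<close>

text \<open>A local chart of the boundary at \<open>p\<close>: in the orthonormal coordinates \<open>(y, t)\<close> given by the
  linear isometry \<open>T\<close>, inside the cylinder \<open>\<bar>y\<bar> < r\<close>, \<open>\<bar>t\<bar> < h\<close> the set \<open>U\<close> is the region strictly
  below the graph of the \<open>C\<^sup>2\<^sup>,\<^sup>1\<close> function \<open>\<gamma>\<close> and its boundary is the graph.\<close>

definition C21_chart ::
  "(real^3) set \<Rightarrow> real^3 \<Rightarrow> ((real^2) \<times> real \<Rightarrow> real^3) \<Rightarrow> real \<Rightarrow> real \<Rightarrow> (real^2 \<Rightarrow> real) \<Rightarrow> bool" where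
  "C21_chart U p T r h \<gamma> \<longleftrightarrow>
     linear T \<and> (\<forall>z. norm (T z) = norm z) \<and> 0 < r \<and> 0 < h \<and>
     CkLip_on 2 (ball 0 r) \<gamma> \<and> \<gamma> 0 = 0 \<and> (\<forall>y\<in>ball 0 r. \<bar>\<gamma> y\<bar> < h) \<and>
     (\<forall>y\<in>ball 0 r. \<forall>t\<in>{-h<..<h}.
        (p + T (y, t) \<in> U \<longleftrightarrow> t < \<gamma> y) \<and> (p + T (y, t) \<in> frontier U \<longleftrightarrow> t = \<gamma> y))"

definition C21_boundary :: "(real^3) set \<Rightarrow> bool" where
  "C21_boundary U \<longleftrightarrow> (\<forall>p\<in>frontier U. \<exists>T r h \<gamma>. C21_chart U p T r h \<gamma>)"

text \<open>Two-dimensional Hausdorff (outer) measure, normalised by \<open>\<pi>/4\<close> so that it is the area on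
  planes.\<close>

definition hausdorff2_pre :: "real \<Rightarrow> 'a::metric_space set \<Rightarrow> ennreal" where
  "hausdorff2_pre \<delta> A =
     (INF C\<in>{C :: nat \<Rightarrow> 'a set. A \<subseteq> (\<Union>n. C n) \<and> (\<forall>n. bounded (C n) \<and> diameter (C n) \<le> \<delta>)}.
        \<Sum>n. ennreal (pi / 4 * (diameter (C n))\<^sup>2))"

definition hausdorff2 :: "'a::metric_space set \<Rightarrow> ennreal" where
  "hausdorff2 A = (SUP \<delta>\<in>{0<..}. hausdorff2_pre \<delta> A)"

definition hausdorff2_measure :: "'a::metric_space measure" where
  "hausdorff2_measure = measure_of UNIV (sets borel) hausdorff2"

lemma hausdorff2_pre_mono: "A \<subseteq> B \<Longrightarrow> hausdorff2_pre \<delta> A \<le> hausdorff2_pre \<delta> B"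
  unfolding hausdorff2_pre_def by (rule INF_superset_mono) auto

lemma hausdorff2_pre_antimono: "\<delta> \<le> \<delta>' \<Longrightarrow> hausdorff2_pre \<delta>' A \<le> hausdorff2_pre \<delta> A"
  unfolding hausdorff2_pre_def by (rule INF_superset_mono) (auto intro: order_trans)

lemma hausdorff2_pre_empty:
  assumes "0 < \<delta>" shows "hausdorff2_pre \<delta> {} = 0"
proof -
  have "hausdorff2_pre \<delta> {} \<le> (\<Sum>n::nat. ennreal (pi / 4 * (diameter ({} :: 'a set))\<^sup>2))"
    unfolding hausdorff2_pre_def by (rule INF_lower2[of "\<lambda>_. {}"]) (use assms in auto)
  then show ?thesis by simp
qed

lemma hausdorff2_pre_subadditive:
  fixes A :: "nat \<Rightarrow> 'a::metric_space set"
  shows "hausdorff2_pre \<delta> (\<Union>n. A n) \<le> (\<Sum>n. hausdorff2_pre \<delta> (A n))"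
proof (rule ennreal_le_epsilon)
  fix e :: real
  assume e: "0 < e" and fin: "(\<Sum>n. hausdorff2_pre \<delta> (A n)) < top_class.top"
  let ?w = "\<lambda>C :: 'a set. ennreal (pi / 4 * (diameter C)\<^sup>2)"
  have "\<exists>C. A n \<subseteq> (\<Union>i. C i) \<and> (\<forall>i. bounded (C i) \<and> diameter (C i) \<le> \<delta>) \<and>
            (\<Sum>i::nat. ?w (C i)) \<le> hausdorff2_pre \<delta> (A n) + ennreal (e * (1/2) ^ Suc n)" for n
  proof -
    have "hausdorff2_pre \<delta> (A n) < hausdorff2_pre \<delta> (A n) + ennreal (e * (1/2) ^ Suc n)"
      using fin e by (auto simp: less_top dest!: ennreal_suminf_lessD)
    then obtain C where "C \<in> {C. A n \<subseteq> (\<Union>i. C i) \<and> (\<forall>i. bounded (C i) \<and> diameter (C i) \<le> \<delta>)}"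
      "(\<Sum>i::nat. ?w (C i)) < hausdorff2_pre \<delta> (A n) + ennreal (e * (1/2) ^ Suc n)"
      unfolding hausdorff2_pre_def[of \<delta> "A n"] INF_less_iff by blast
    then show ?thesis by (intro exI[of _ C]) auto
  qed
  then obtain B where B: "\<And>n. A n \<subseteq> (\<Union>i. B n i)"
      "\<And>n i. bounded (B n i)" "\<And>n i. diameter (B n i) \<le> \<delta>"
      "\<And>n. (\<Sum>i::nat. ?w (B n i)) \<le> hausdorff2_pre \<delta> (A n) + ennreal (e * (1/2) ^ Suc n)"
    by metis
  define C where "C = case_prod B o prod_decode"
  have A_C: "(\<Union>i. A i) \<subseteq> (\<Union>i. C i)"
    using B(1) by (auto simp add: C_def subset_eq) (metis prod.case prod_encode_inverse)
  have "hausdorff2_pre \<delta> (\<Union>n. A n) \<le> (\<Sum>i. ?w (C i))"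
    unfolding hausdorff2_pre_def
    by (rule INF_lower) (use A_C B in \<open>auto simp: C_def split: prod.split\<close>)
  also have "\<dots> = (\<Sum>i. (\<lambda>(n, j). ?w (B n j)) (prod_decode i))"
    by (simp add: C_def case_prod_beta)
  also have "\<dots> = (\<Sum>n. \<Sum>i. ?w (B n i))"
    by (rule suminf_ennreal_2dimen[unfolded comp_def]) simp
  also have "\<dots> \<le> (\<Sum>n. hausdorff2_pre \<delta> (A n) + ennreal (e * (1/2) ^ Suc n))"
    by (intro suminf_le B) auto
  also have "\<dots> = (\<Sum>n. hausdorff2_pre \<delta> (A n)) + (\<Sum>n. ennreal e * ennreal ((1/2) ^ Suc n))"
    using e by (subst suminf_add[symmetric])
      (auto simp del: ennreal_suminf_cmult simp add: ennreal_mult[symmetric])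
  also have "\<dots> = (\<Sum>n. hausdorff2_pre \<delta> (A n)) + e"
    unfolding ennreal_suminf_cmult
    by (subst suminf_ennreal_eq[OF zero_le_power power_half_series]) auto
  finally show "hausdorff2_pre \<delta> (\<Union>n. A n) \<le> (\<Sum>n. hausdorff2_pre \<delta> (A n)) + e" .
qed

lemma hausdorff2_pre_le: "0 < \<delta> \<Longrightarrow> hausdorff2_pre \<delta> A \<le> hausdorff2 A"
  unfolding hausdorff2_def by (rule SUP_upper) auto

lemma hausdorff2_mono: "A \<subseteq> B \<Longrightarrow> hausdorff2 A \<le> hausdorff2 B"
  unfolding hausdorff2_def by (intro SUP_mono) (auto intro: hausdorff2_pre_mono)

lemma hausdorff2_empty: "hausdorff2 {} = 0"
  unfolding hausdorff2_def by (simp add: hausdorff2_pre_empty cong: SUP_cong_simp)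

lemma hausdorff2_subadditive:
  fixes A :: "nat \<Rightarrow> 'a::metric_space set"
  shows "hausdorff2 (\<Union>n. A n) \<le> (\<Sum>n. hausdorff2 (A n))"
  unfolding hausdorff2_def[of "\<Union>n. A n"]
proof (rule SUP_least)
  fix \<delta> :: real assume "\<delta> \<in> {0<..}"
  then have "(\<Sum>n. hausdorff2_pre \<delta> (A n)) \<le> (\<Sum>n. hausdorff2 (A n))"
    by (intro suminf_le hausdorff2_pre_le) auto
  with hausdorff2_pre_subadditive[of \<delta> A]
  show "hausdorff2_pre \<delta> (\<Union>n. A n) \<le> (\<Sum>n. hausdorff2 (A n))" by (rule order_trans)
qed

lemma hausdorff2_outer_measure_space:
  "outer_measure_space (Pow UNIV) (hausdorff2 :: 'a::metric_space set \<Rightarrow> ennreal)"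
  unfolding outer_measure_space_def positive_def increasing_def countably_subadditive_def
  by (auto simp: hausdorff2_empty hausdorff2_mono hausdorff2_subadditive)

lemma hausdorff2_subadditive2: "hausdorff2 (A \<union> B) \<le> hausdorff2 A + hausdorff2 B"
proof -
  have "hausdorff2 (\<Union>n. binaryset A B n) \<le> (\<Sum>n. hausdorff2 (binaryset A B n))"
    by (rule hausdorff2_subadditive)
  then show ?thesis
    using suminf_binaryset_eq[of hausdorff2 A B] by (simp add: UN_binaryset_eq hausdorff2_empty)
qed

lemma hausdorff2_separated:
  fixes A B :: "'a::metric_space set"
  assumes d: "0 < d" "\<And>x y. x \<in> A \<Longrightarrow> y \<in> B \<Longrightarrow> d \<le> dist x y"
  shows "hausdorff2 A + hausdorff2 B \<le> hausdorff2 (A \<union> B)"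
proof -
  let ?w = "\<lambda>C :: 'a set. ennreal (pi / 4 * (diameter C)\<^sup>2)"
  have pre: "hausdorff2_pre \<delta> A + hausdorff2_pre \<delta> B \<le> hausdorff2_pre \<delta> (A \<union> B)"
    if \<delta>: "0 < \<delta>" "\<delta> < d" for \<delta>
    unfolding hausdorff2_pre_def[of \<delta> "A \<union> B"]
  proof (rule INF_greatest)
    fix C :: "nat \<Rightarrow> 'a set"
    assume "C \<in> {C. A \<union> B \<subseteq> (\<Union>n. C n) \<and> (\<forall>n. bounded (C n) \<and> diameter (C n) \<le> \<delta>)}"
    then have C: "A \<union> B \<subseteq> (\<Union>n. C n)" "\<And>n. bounded (C n)" "\<And>n. diameter (C n) \<le> \<delta>" by auto
    define CA where "CA n = (if C n \<inter> A = {} then {} else C n)" for n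
    define CB where "CB n = (if C n \<inter> B = {} then {} else C n)" for n
    have covA: "x \<in> (\<Union>n. CA n)" if "x \<in> A" for x
    proof -
      obtain n where "x \<in> C n" using C(1) \<open>x \<in> A\<close> by blast
      with \<open>x \<in> A\<close> show ?thesis by (intro UN_I[of n]) (auto simp: CA_def)
    qed
    have covB: "x \<in> (\<Union>n. CB n)" if "x \<in> B" for x
    proof -
      obtain n where "x \<in> C n" using C(1) \<open>x \<in> B\<close> by blast
      with \<open>x \<in> B\<close> show ?thesis by (intro UN_I[of n]) (auto simp: CB_def)
    qed
    have disj: "C n \<inter> A = {} \<or> C n \<inter> B = {}" for n
    proof (rule ccontr)
      assume "\<not> ?thesis"
      then obtain x y where "x \<in> C n" "x \<in> A" "y \<in> C n" "y \<in> B" by blast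
      with d(2) diameter_bounded_bound[OF C(2), of x n y] C(3)[of n] \<delta>
      show False by fastforce
    qed
    have "hausdorff2_pre \<delta> A \<le> (\<Sum>n. ?w (CA n))"
      unfolding hausdorff2_pre_def
      by (rule INF_lower, safe, erule covA) (use C(2,3) \<delta> in \<open>simp_all add: CA_def\<close>)
    moreover have "hausdorff2_pre \<delta> B \<le> (\<Sum>n. ?w (CB n))"
      unfolding hausdorff2_pre_def
      by (rule INF_lower, safe, erule covB) (use C(2,3) \<delta> in \<open>simp_all add: CB_def\<close>)
    ultimately have "hausdorff2_pre \<delta> A + hausdorff2_pre \<delta> B \<le> (\<Sum>n. ?w (CA n)) + (\<Sum>n. ?w (CB n))"
      by (rule add_mono)
    also have "\<dots> = (\<Sum>n. ?w (CA n) + ?w (CB n))"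
      by (rule suminf_add) auto
    also have "\<dots> \<le> (\<Sum>n. ?w (C n))"
      by (rule suminf_le) (use disj in \<open>auto simp: CA_def CB_def\<close>)
    finally show "hausdorff2_pre \<delta> A + hausdorff2_pre \<delta> B \<le> (\<Sum>n. ?w (C n))" .
  qed
  have "hausdorff2_pre \<delta> A + hausdorff2_pre \<delta>' B \<le> hausdorff2 (A \<union> B)"
    if "0 < \<delta>" "0 < \<delta>'" for \<delta> \<delta>'
  proof -
    define \<epsilon> where "\<epsilon> = min (min \<delta> \<delta>') (d / 2)"
    have \<epsilon>: "0 < \<epsilon>" "\<epsilon> < d" "\<epsilon> \<le> \<delta>" "\<epsilon> \<le> \<delta>'" using that d(1) by (auto simp: \<epsilon>_def)
    have "hausdorff2_pre \<delta> A + hausdorff2_pre \<delta>' B \<le> hausdorff2_pre \<epsilon> A + hausdorff2_pre \<epsilon> B"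
      by (intro add_mono hausdorff2_pre_antimono \<epsilon>)
    also have "\<dots> \<le> hausdorff2 (A \<union> B)"
      using pre[OF \<epsilon>(1,2)] hausdorff2_pre_le[OF \<epsilon>(1), of "A \<union> B"] by (rule order_trans)
    finally show ?thesis .
  qed
  moreover have "{0::real<..} \<noteq> {}" using gt_ex by auto
  ultimately show ?thesis
    unfolding hausdorff2_def[of A] hausdorff2_def[of B]
    by (subst ennreal_SUP_add_left[symmetric], simp, intro SUP_least,
        subst ennreal_SUP_add_right, simp, intro SUP_least) auto
qed

lemma hausdorff2_separated_sum:
  fixes B :: "nat \<Rightarrow> 'a::metric_space set"
  assumes "\<And>n. \<exists>d>0. \<forall>i<n. \<forall>x\<in>B i. \<forall>y\<in>B n. d \<le> dist x y"
  shows "(\<Sum>i<n. hausdorff2 (B i)) \<le> hausdorff2 (\<Union>i<n. B i)"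
proof (induction n)
  case (Suc n)
  obtain d where d: "d > 0" "\<forall>i<n. \<forall>x\<in>B i. \<forall>y\<in>B n. d \<le> dist x y" using assms by blast
  have "(\<Sum>i<Suc n. hausdorff2 (B i)) \<le> hausdorff2 (\<Union>i<n. B i) + hausdorff2 (B n)"
    using Suc by (simp add: add_right_mono)
  also have "\<dots> \<le> hausdorff2 ((\<Union>i<n. B i) \<union> B n)"
    by (rule hausdorff2_separated[OF d(1)]) (use d(2) in auto)
  also have "(\<Union>i<n. B i) \<union> B n = (\<Union>i<Suc n. B i)"
    by (auto simp: less_Suc_eq)
  finally show ?case .
qed simp

lemma hausdorff2_closed:
  fixes F A :: "'a::metric_space set"
  assumes F: "closed F"
  shows "hausdorff2 (A \<inter> F) + hausdorff2 (A - F) \<le> hausdorff2 A"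
proof (cases "hausdorff2 A = top_class.top")
  case False
  define E where "E n = {x\<in>A. \<forall>y\<in>F. 1 / real (Suc n) \<le> dist x y}" for n :: nat
  define R where "R n = E (Suc n) - E n" for n
  have E_mono: "E m \<subseteq> E n" if "m \<le> n" for m n
  proof -
    have "1 / real (Suc n) \<le> 1 / real (Suc m)" using that by (simp add: frac_le)
    then show ?thesis unfolding E_def by (auto intro: order_trans)
  qed
  have E_Un: "x \<in> (\<Union>n. E n)" if x: "x \<in> A" "x \<notin> F" for x
  proof -
    obtain e where "e > 0" "ball x e \<subseteq> - F"
      using F x(2) by (metis openE ComplI open_Compl)
    then have e: "e > 0" "\<forall>y\<in>F. e \<le> dist x y" by (auto simp: subset_eq not_less[symmetric])
    obtain n where "1 / real (Suc n) < e" using e(1) nat_approx_posE by metis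
    with e(2) x(1) show ?thesis by (force simp: E_def intro!: exI[of _ n])
  qed
  have cover: "A - F \<subseteq> E n \<union> (\<Union>k. R (n + k))" for n
  proof
    fix x assume "x \<in> A - F"
    then obtain m where m: "x \<in> E m" using E_Un by auto
    show "x \<in> E n \<union> (\<Union>k. R (n + k))"
    proof (cases "x \<in> E n")
      case nE: False
      define p where "p = (LEAST m. x \<in> E m)"
      have p: "x \<in> E p" "\<And>q. q < p \<Longrightarrow> x \<notin> E q"
        unfolding p_def using m by (auto intro: LeastI dest: not_less_Least)
      have "n < p" using E_mono[of p n] p(1) nE by (meson in_mono not_le)
      then obtain k where k: "p = Suc (n + k)" using less_imp_Suc_add by blast
      then have "x \<in> R (n + k)" using p by (auto simp: R_def)
      then show ?thesis by auto
    qed simp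
  qed
  have sep: "1 / real (j + 2) - 1 / real (j + 3) \<le> dist x z"
    if xz: "x \<in> E (Suc j)" "z \<in> R k" "j + 2 \<le> k" for x z j k
  proof -
    from xz(2) have "z \<in> A" "z \<notin> E k" by (auto simp: R_def E_def)
    then obtain y where y: "y \<in> F" "dist z y < 1 / real (Suc k)" by (auto simp: E_def not_le)
    have "1 / real (Suc k) \<le> 1 / real (j + 3)" using xz(3) by (simp add: frac_le)
    moreover have "1 / real (j + 2) \<le> dist x y" using xz(1) y(1) by (auto simp: E_def add.commute)
    moreover have "dist x y \<le> dist x z + dist z y" by (rule dist_triangle)
    ultimately show ?thesis using y(2) by linarith
  qed
  have R_E: "R i \<subseteq> E (Suc j)" if "i \<le> j" for i j
    using E_mono[of "Suc i" "Suc j"] that by (auto simp: R_def)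
  have R_A: "R i \<subseteq> A" for i by (auto simp: R_def E_def)
  have part: "(\<Sum>i<n. hausdorff2 (R (2 * i + c))) \<le> hausdorff2 A" for n c
  proof -
    have "(\<Sum>i<n. hausdorff2 (R (2 * i + c))) \<le> hausdorff2 (\<Union>i<n. R (2 * i + c))"
    proof (rule hausdorff2_separated_sum)
      fix n
      show "\<exists>d>0. \<forall>i<n. \<forall>x\<in>R (2 * i + c). \<forall>y\<in>R (2 * n + c). d \<le> dist x y"
      proof (cases n)
        case (Suc m)
        let ?j = "2 * m + c"
        have "0 < 1 / real (?j + 2) - 1 / real (?j + 3)"
          using frac_less2[of 1 1 "real (?j + 2)" "real (?j + 3)"] by linarith
        moreover have "1 / real (?j + 2) - 1 / real (?j + 3) \<le> dist x y"
          if "i < n" "x \<in> R (2 * i + c)" "y \<in> R (2 * n + c)" for i x y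
          by (rule sep[of _ _ _ "2 * n + c"]) (use that Suc R_E[of "2 * i + c" ?j] in auto)
        ultimately show ?thesis by blast
      qed (auto intro: exI[of _ 1])
    qed
    also have "\<dots> \<le> hausdorff2 A" by (rule hausdorff2_mono) (use R_A in auto)
    finally show ?thesis .
  qed
  have "(\<Sum>i<n. hausdorff2 (R i)) \<le> 2 * hausdorff2 A" for n
  proof -
    have "(\<Sum>i<n. hausdorff2 (R i)) \<le> (\<Sum>i<2 * n. hausdorff2 (R i))"
      by (rule sum_mono2) auto
    also have "\<dots> = (\<Sum>i<n. hausdorff2 (R (2 * i + 0))) + (\<Sum>i<n. hausdorff2 (R (2 * i + 1)))"
      by (induction n) (simp_all add: algebra_simps)
    also have "\<dots> \<le> hausdorff2 A + hausdorff2 A" by (intro add_mono part)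
    finally show ?thesis by (simp add: mult_2)
  qed
  then have "(\<Sum>i. hausdorff2 (R i)) \<le> 2 * hausdorff2 A"
    by (intro suminf_le_const) auto
  then have fin: "(\<Sum>i. hausdorff2 (R i)) < top_class.top"
    using False by (auto simp: less_top[symmetric] ennreal_mult_eq_top_iff top_unique)
  have main: "hausdorff2 (A \<inter> F) + hausdorff2 (A - F) \<le> hausdorff2 A + (\<Sum>k. hausdorff2 (R (k + n)))" for n
  proof -
    have "hausdorff2 (A - F) \<le> hausdorff2 (E n \<union> (\<Union>k. R (n + k)))"
      by (rule hausdorff2_mono[OF cover])
    also have "\<dots> \<le> hausdorff2 (E n) + hausdorff2 (\<Union>k. R (n + k))"
      by (rule hausdorff2_subadditive2)
    also have "\<dots> \<le> hausdorff2 (E n) + (\<Sum>k. hausdorff2 (R (n + k)))"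
      by (intro add_left_mono hausdorff2_subadditive)
    finally have 1: "hausdorff2 (A - F) \<le> hausdorff2 (E n) + (\<Sum>k. hausdorff2 (R (k + n)))"
      by (simp add: add.commute)
    have "hausdorff2 (A \<inter> F) + hausdorff2 (E n) \<le> hausdorff2 (A \<inter> F \<union> E n)"
      by (rule hausdorff2_separated[of "1 / real (Suc n)"]) (auto simp: E_def dist_commute)
    also have "\<dots> \<le> hausdorff2 A" by (rule hausdorff2_mono) (auto simp: E_def)
    finally have 2: "hausdorff2 (A \<inter> F) + hausdorff2 (E n) \<le> hausdorff2 A" .
    have "hausdorff2 (A \<inter> F) + hausdorff2 (A - F)
        \<le> hausdorff2 (A \<inter> F) + hausdorff2 (E n) + (\<Sum>k. hausdorff2 (R (k + n)))"
      using add_left_mono[OF 1, of "hausdorff2 (A \<inter> F)"] by (simp add: add.assoc)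
    also have "\<dots> \<le> hausdorff2 A + (\<Sum>k. hausdorff2 (R (k + n)))"
      by (rule add_right_mono[OF 2])
    finally show ?thesis .
  qed
  have tail: "(\<lambda>n. \<Sum>k. hausdorff2 (R (k + n))) \<longlonglongrightarrow> 0"
  proof -
    have nt: "hausdorff2 (R i) \<noteq> top_class.top" for i
      using ennreal_suminf_lessD[OF fin, of i] by auto
    define r where "r i = enn2real (hausdorff2 (R i))" for i
    have r: "hausdorff2 (R i) = ennreal (r i)" "0 \<le> r i" for i
      using nt by (auto simp: r_def less_top)
    have sm: "summable r"
      by (rule summable_suminf_not_top) (use r fin in \<open>auto simp: r(1)[symmetric]\<close>)
    have "(\<Sum>k. hausdorff2 (R (k + n))) = ennreal (\<Sum>k. r (k + n))" for n
      unfolding r(1)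
      by (rule suminf_ennreal2) (use r sm in \<open>auto simp: summable_iff_shift\<close>)
    moreover have "(\<lambda>n. \<Sum>k. r (k + n)) \<longlonglongrightarrow> 0"
      using suminf_exist_split2[OF sm] .
    then have "(\<lambda>n. ennreal (\<Sum>k. r (k + n))) \<longlonglongrightarrow> ennreal 0"
      by (rule tendsto_ennrealI)
    ultimately show ?thesis by simp
  qed
  have "(\<lambda>n. hausdorff2 A + (\<Sum>k. hausdorff2 (R (k + n)))) \<longlonglongrightarrow> hausdorff2 A + 0"
    by (intro tendsto_add tendsto_const tail)
  then show ?thesis
    by (intro LIMSEQ_le_const) (use main in auto)
qed simp

text \<open>Caratheodory's criterion: the measure of a Borel set is its outer measure.\<close>

lemma emeasure_hausdorff2_measure:
  fixes A :: "'a::metric_space set"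
  assumes "A \<in> sets borel"
  shows "emeasure hausdorff2_measure A = hausdorff2 A"
proof -
  interpret P: sigma_algebra "UNIV :: 'a set" "Pow UNIV" by (rule sigma_algebra_Pow)
  let ?L = "lambda_system (UNIV :: 'a set) (Pow UNIV) hausdorff2"
  have ms: "measure_space UNIV ?L hausdorff2"
    by (rule P.caratheodory_lemma[OF hausdorff2_outer_measure_space])
  then have L: "sigma_algebra UNIV ?L" by (simp add: measure_space_def)
  have "closed F \<Longrightarrow> F \<in> ?L" for F
    unfolding P.lambda_system_eq
    using hausdorff2_closed[of F] hausdorff2_subadditive2[of "x \<inter> F" "x - F" for x]
    by (auto intro!: antisym simp: Int_Diff_Un)
  then have "sigma_sets UNIV (Collect closed) \<subseteq> ?L"
    by (intro sigma_algebra.sigma_sets_subset[OF L]) auto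
  then have sub: "sets borel \<subseteq> ?L"
    by (simp add: borel_eq_closed)
  have "measure_space UNIV (sets borel) (hausdorff2 :: 'a set \<Rightarrow> ennreal)"
    by (rule measure_down[OF ms _ sub]) (metis sets.sigma_algebra_axioms space_borel)
  then show ?thesis
    unfolding hausdorff2_measure_def using assms
    by (intro emeasure_measure_of_sigma)
       (auto simp: measure_space_def)
qed

definition surface :: "'a::metric_space set \<Rightarrow> 'a measure" where
  "surface U = completion (restrict_space hausdorff2_measure (frontier U))"

text \<open>Functions of class \<open>H\<^sup>5\<^sup>/\<^sup>2\<close> on a \<open>C\<^sup>2\<^sup>,\<^sup>1\<close> boundary, via local coordinates.\<close>

definition H52_boundary :: "(real^3) set \<Rightarrow> (real^3 \<Rightarrow> real) set" where
  "H52_boundary U =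
     {f \<in> L2 (surface U).
        \<forall>p\<in>frontier U. \<exists>T r h \<gamma>. C21_chart U p T r h \<gamma> \<and>
          H_frac (1/2) 2 (ball 0 r) (\<lambda>y. f (p + T (y, \<gamma> y)))}"

text \<open>The trace of an \<open>H\<^sup>1\<close> function on the boundary of a bounded Lipschitz domain: the continuous
  extension to \<open>H\<^sup>1\<close> of restriction to the boundary, using density of (restrictions of) smooth
  functions on the whole space. It is determined up to a null set of the surface measure.\<close>

definition is_trace :: "'a::euclidean_space set \<Rightarrow> ('a \<Rightarrow> real) \<Rightarrow> ('a \<Rightarrow> real) \<Rightarrow> bool" where
  "is_trace U u w \<longleftrightarrow>
     w \<in> L2 (surface U) \<and>
     (\<exists>v. (\<forall>k. smooth (v k)) \<and>
          (\<lambda>k. L2_norm (lebesgue_on U) (\<lambda>x. v k x - u x)) \<longlonglongrightarrow> 0 \<and>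
          (\<lambda>k. L2_norm (lebesgue_on U) (\<lambda>x. norm (grad (v k) x - wgrad U u x))) \<longlonglongrightarrow> 0 \<and>
          (\<lambda>k. L2_norm (surface U) (\<lambda>x. v k x - w x)) \<longlonglongrightarrow> 0)"

definition trace_op :: "'a::euclidean_space set \<Rightarrow> ('a \<Rightarrow> real) \<Rightarrow> 'a \<Rightarrow> real" where
  "trace_op U u = (SOME w. is_trace U u w)"

section \<open>Matrices of the \<open>SP\<^sub>N\<close> system\<close>

text \<open>Legendre polynomials by Rodrigues' formula.\<close>

definition legendre :: "nat \<Rightarrow> real poly" where
  "legendre l = Polynomial.smult (1 / (2 ^ l * fact l)) ((pderiv ^^ l) ([:-1, 0, 1:] ^ l))"

text \<open>Library matrices and vectors are indexed from \<open>0\<close>; the entries below are given with indices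
  from \<open>1\<close>.\<close>

definition mat1 :: "nat \<Rightarrow> (nat \<Rightarrow> nat \<Rightarrow> real) \<Rightarrow> real mat" where
  "mat1 m a = mat m m (\<lambda>(i, j). a (Suc i) (Suc j))"

definition diag1 :: "nat \<Rightarrow> (nat \<Rightarrow> real) \<Rightarrow> real mat" where
  "diag1 m d = mat1 m (\<lambda>i j. if i = j then d i else 0)"

definition vec1 :: "nat \<Rightarrow> (nat \<Rightarrow> real) \<Rightarrow> real Matrix.vec" where
  "vec1 m a = Matrix.vec m (\<lambda>i. a (Suc i))"

text \<open>The library function yields \<open>None\<close> exactly for singular matrices; it is applied below only to
  triangular matrices with nonzero diagonal.\<close>

definition minv :: "real mat \<Rightarrow> real mat" where
  "minv A = the (mat_inverse A)"

definition M_mat :: "nat \<Rightarrow> real mat" where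
  "M_mat m = mat1 m (\<lambda>n k. if k = n then 2 * real n - 1 else if k = n + 1 then 2 * real n else 0)"

definition L_mat :: "nat \<Rightarrow> real mat" where
  "L_mat m = diag1 m (\<lambda>n. 1 / (4 * real n - 3))"

definition R_mat :: "nat \<Rightarrow> real mat" where
  "R_mat m = mat1 m (\<lambda>i j. (4 * real j - 3) *
     integral {0..1} (\<lambda>x. poly (legendre (2 * i - 1)) x * poly (legendre (2 * j - 2)) x))"

text \<open>\<open>k\<^sub>l\<close>; only odd \<open>l\<close> occur.\<close>

definition k_coeff :: "nat \<Rightarrow> real" where
  "k_coeff l = integral {0..1} (\<lambda>x. poly (legendre l) x)"

text \<open>\<open>\<^bold>s\<^sub>k\<close>, with \<open>k\<close> counted from \<open>1\<close>.\<close>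

definition s_row :: "nat \<Rightarrow> nat \<Rightarrow> real Matrix.vec" where
  "s_row m k = Matrix.row (minv (M_mat m)) (k - 1)"

section \<open>Coefficients, the \<open>SP\<^sub>N\<close> system and the internal datum\<close>

definition admissible ::
  "(real^3) set \<Rightarrow> real \<Rightarrow> real \<Rightarrow> real \<Rightarrow>
   (real^3 \<Rightarrow> real) \<Rightarrow> (real^3 \<Rightarrow> real) \<Rightarrow> (real^3 \<Rightarrow> real) \<Rightarrow> bool" where
  "admissible \<Omega> c_lo c_hi M0 \<sigma>a \<sigma>s \<Upsilon> \<longleftrightarrow>
     (\<forall>x\<in>closure \<Omega>. c_lo \<le> \<sigma>a x \<and> \<sigma>a x \<le> c_hi \<and> c_lo \<le> \<sigma>s x \<and> \<sigma>s x \<le> c_hi) \<and>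
     C11_closure \<Omega> \<sigma>a \<and> C11_norm \<Omega> \<sigma>a \<le> ennreal M0 \<and>
     C11_closure \<Omega> \<sigma>s \<and> C11_norm \<Omega> \<sigma>s \<le> ennreal M0 \<and>
     \<Upsilon> \<in> borel_measurable (lebesgue_on \<Omega>) \<and>
     (AE x in lebesgue_on \<Omega>. c_lo \<le> \<Upsilon> x \<and> \<Upsilon> x \<le> c_hi)"

text \<open>The simplified coefficients \<open>\<sigma>\<^sub>n\<close>.\<close>

definition sig :: "real \<Rightarrow> (real^3 \<Rightarrow> real) \<Rightarrow> (real^3 \<Rightarrow> real) \<Rightarrow> nat \<Rightarrow> real^3 \<Rightarrow> real" where
  "sig g \<sigma>a \<sigma>s n x = (if n = 0 then \<sigma>a x else (1 - g ^ n) * \<sigma>s x)"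

definition Sigma_e ::
  "real \<Rightarrow> (real^3 \<Rightarrow> real) \<Rightarrow> (real^3 \<Rightarrow> real) \<Rightarrow> nat \<Rightarrow> real^3 \<Rightarrow> real mat" where
  "Sigma_e g \<sigma>a \<sigma>s m x = diag1 m (\<lambda>n. sig g \<sigma>a \<sigma>s (2 * n - 2) x)"

text \<open>Weak solutions; \<open>\<Phi> n\<close> is \<open>\<phi>\<^sub>n\<close> for \<open>1 \<le> n \<le> m\<close>, other indices are irrelevant.\<close>

definition SPN_solution ::
  "(real^3) set \<Rightarrow> real \<Rightarrow> nat \<Rightarrow> (real^3 \<Rightarrow> real) \<Rightarrow> (real^3 \<Rightarrow> real) \<Rightarrow> (real^3 \<Rightarrow> real) \<Rightarrow>
   (nat \<Rightarrow> real^3 \<Rightarrow> real) \<Rightarrow> bool" where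
  "SPN_solution \<Omega> g N \<sigma>a \<sigma>s f \<Phi> \<longleftrightarrow>
    (let m = (N + 1) div 2; Mi = minv (M_mat m); Li = minv (L_mat m) in
      (\<forall>n\<in>{1..m}. \<Phi> n \<in> Sobolev_H1 \<Omega>) \<and>
      (\<forall>\<Psi>. (\<forall>n\<in>{1..m}. \<Psi> n \<in> Sobolev_H1 \<Omega>) \<longrightarrow>
        (\<Sum>n=1..m. \<integral>x. inner (wgrad \<Omega> (\<Phi> n) x) (wgrad \<Omega> (\<Psi> n) x)
                         / ((4 * real n - 1) * sig g \<sigma>a \<sigma>s (2 * n - 1) x) \<partial>lebesgue_on \<Omega>)
        + (\<integral>x. scalar_prod
                 ((transpose_mat Mi * Li * Sigma_e g \<sigma>a \<sigma>s m x * Mi) *\<^sub>v vec1 m (\<lambda>n. \<Phi> n x))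
                 (vec1 m (\<lambda>n. \<Psi> n x)) \<partial>lebesgue_on \<Omega>)
        + (\<integral>x. scalar_prod
                 ((R_mat m * Mi) *\<^sub>v vec1 m (\<lambda>n. trace_op \<Omega> (\<Phi> n) x))
                 (vec1 m (\<lambda>n. trace_op \<Omega> (\<Psi> n) x)) \<partial>surface \<Omega>)
        = (\<Sum>n=1..m. k_coeff (2 * n - 1) * (\<integral>x. f x * trace_op \<Omega> (\<Psi> n) x \<partial>surface \<Omega>))))"

definition internal_datum ::
  "nat \<Rightarrow> (real^3 \<Rightarrow> real) \<Rightarrow> (real^3 \<Rightarrow> real) \<Rightarrow> (nat \<Rightarrow> real^3 \<Rightarrow> real) \<Rightarrow> real^3 \<Rightarrow> real" where
  "internal_datum N \<Upsilon> \<sigma>a \<Phi> x =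
     (let m = (N + 1) div 2 in \<Upsilon> x * \<sigma>a x * scalar_prod (s_row m 1) (vec1 m (\<lambda>n. \<Phi> n x)))"

end

theory Submission
  imports Defs
begin

text \<open>Put \<open>w\<close> = s_1 . \<Phi>, so that H_i = \<Upsilon>_i \<sigma>a
  \<open>w\<close> with the same \<open>w\<close> for both data. Then H_1 / \<Upsilon>_1 = \<sigma>a
  \<open>w\<close> and (H_1 - H_2) / \<sigma>a = (\<Upsilon>_1 - \<Upsilon>_2) \<open>w\<close>: the
  left-hand function is \<sigma>a times the right-hand one. Since 0 < \<sigma>a \<le>
  \<open>c_hi\<close> on \<Omega>, the estimate holds with C = \<open>c_hi\<close>, whatever N is.
  What remains is integrability. \<open>L2_norm\<close> is built on the Bochner integral, which is 0
  for a nonintegrable function, so (\<Upsilon>_1 - \<Upsilon>_2) \<open>w\<close> must be shown to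
  lie in L2 before norms are compared. \<open>L2_sum_mult\<close> gives this for \<open>w\<close>,
  \<open>L2_bounded_mult\<close> for the product, and \<open>L2_norm_le_mult\<close> turns the
  pointwise bound into one of norms.\<close>

lemma L2_sum_mult:
  assumes "finite I" "\<And>i. i \<in> I \<Longrightarrow> u i \<in> L2 M"
  shows "(\<lambda>x. \<Sum>i\<in>I. a i * u i x) \<in> L2 M"
proof -
  have m: "u i \<in> borel_measurable M" if "i \<in> I" for i
    using assms(2)[OF that] by (simp add: L2_def)
  then have meas: "(\<lambda>x. \<Sum>i\<in>I. a i * u i x) \<in> borel_measurable M"
    by (intro borel_measurable_sum borel_measurable_times) auto
  have "integrable M (\<lambda>x. \<Sum>i\<in>I. (u i x)\<^sup>2)"
    using assms(2) by (intro Bochner_Integration.integrable_sum) (auto simp: L2_def)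
  \<comment> \<open>The Cauchy-Schwarz majorant of the squared linear combination.\<close>
  then have "integrable M (\<lambda>x. (\<Sum>i\<in>I. (a i)\<^sup>2) * (\<Sum>i\<in>I. (u i x)\<^sup>2))"
    by (rule integrable_mult_right)
  then have "integrable M (\<lambda>x. (\<Sum>i\<in>I. a i * u i x)\<^sup>2)"
  proof (rule Bochner_Integration.integrable_bound)
    show "AE x in M. norm ((\<Sum>i\<in>I. a i * u i x)\<^sup>2)
        \<le> norm ((\<Sum>i\<in>I. (a i)\<^sup>2) * (\<Sum>i\<in>I. (u i x)\<^sup>2))"
      by (auto simp: sum_nonneg Cauchy_Schwarz_ineq_sum)
  qed (use meas in measurable)
  with meas show ?thesis by (simp add: L2_def)
qed

lemma L2_bounded_mult:
  assumes "u \<in> L2 M" "b \<in> borel_measurable M" "AE x in M. \<bar>b x\<bar> \<le> B"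
  shows "(\<lambda>x. b x * u x) \<in> L2 M"
proof -
  have u: "u \<in> borel_measurable M" "integrable M (\<lambda>x. (u x)\<^sup>2)"
    using assms(1) by (auto simp: L2_def)
  have "integrable M (\<lambda>x. (b x * u x)\<^sup>2)"
  proof (rule Bochner_Integration.integrable_bound)
    show "integrable M (\<lambda>x. B\<^sup>2 * (u x)\<^sup>2)"
      using u(2) by (rule integrable_mult_right)
    show "AE x in M. norm ((b x * u x)\<^sup>2) \<le> norm (B\<^sup>2 * (u x)\<^sup>2)"
      using assms(3)
      by eventually_elim (auto simp: power_mult_distrib intro!: mult_right_mono abs_le_square_iff[THEN iffD1])
  qed (use u assms(2) in measurable)
  with u(1) assms(2) show ?thesis by (simp add: L2_def)
qed

text \<open>Membership of \<open>v\<close> in L2 is essential: otherwise its \<open>L2_norm\<close>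
  could be 0 by the default value of the integral. If the square of \<open>u\<close> is not
  integrable, the left side is 0 by the same default and the bound still holds.\<close>

lemma L2_norm_le_mult:
  assumes "v \<in> L2 M" "0 \<le> C" "AE x in M. \<bar>u x\<bar> \<le> C * \<bar>v x\<bar>"
  shows "L2_norm M u \<le> C * L2_norm M v"
proof -
  have "(\<integral>x. (u x)\<^sup>2 \<partial>M) \<le> (\<integral>x. C\<^sup>2 * (v x)\<^sup>2 \<partial>M)"
  proof (rule integral_mono_AE')
    show "AE x in M. (u x)\<^sup>2 \<le> C\<^sup>2 * (v x)\<^sup>2"
      using assms(3)
    proof eventually_elim
      case (elim x)
      then show ?case using power_mono[OF elim abs_ge_zero, of 2] by (simp add: power_mult_distrib)
    qed
  qed (use assms(1) in \<open>auto simp: L2_def\<close>)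
  then show ?thesis
    using assms(2) real_sqrt_le_mono by (fastforce simp: L2_norm_def real_sqrt_mult)
qed

theorem theorem3p5:
  fixes \<Omega> :: "(real^3) set" and g c_lo c_hi M0 :: real
  assumes "open \<Omega>" and "connected \<Omega>" and "\<Omega> \<noteq> {}" and "bounded \<Omega>" and "simply_connected \<Omega>"
    and "C21_boundary \<Omega>"
    and "-1 < g" and "g < 1" and "0 < c_lo" and "c_lo \<le> c_hi"
  shows "\<exists>C>0. \<forall>N. odd N \<and> N \<ge> 1 \<longrightarrow>
    (\<forall>\<sigma>a \<sigma>s \<Upsilon>1 \<Upsilon>2 f \<Phi>.
       admissible \<Omega> c_lo c_hi M0 \<sigma>a \<sigma>s \<Upsilon>1 \<and> admissible \<Omega> c_lo c_hi M0 \<sigma>a \<sigma>s \<Upsilon>2 \<and>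
       f \<in> H52_boundary \<Omega> \<and> SPN_solution \<Omega> g N \<sigma>a \<sigma>s f \<Phi> \<longrightarrow>
       (let H1 = internal_datum N \<Upsilon>1 \<sigma>a \<Phi>; H2 = internal_datum N \<Upsilon>2 \<sigma>a \<Phi> in
          L2_norm (lebesgue_on \<Omega>) (\<lambda>x. (\<Upsilon>1 x - \<Upsilon>2 x) * (H1 x / \<Upsilon>1 x))
          \<le> C * L2_norm (lebesgue_on \<Omega>) (\<lambda>x. (H1 x - H2 x) / \<sigma>a x)))"
proof (intro exI[of _ c_hi] conjI allI impI)
  show "0 < c_hi" using assms by linarith
next
  fix N and \<sigma>a \<sigma>s \<Upsilon>1 \<Upsilon>2 f :: "real^3 \<Rightarrow> real" and \<Phi> :: "nat \<Rightarrow> real^3 \<Rightarrow> real"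
  assume "admissible \<Omega> c_lo c_hi M0 \<sigma>a \<sigma>s \<Upsilon>1 \<and> admissible \<Omega> c_lo c_hi M0 \<sigma>a \<sigma>s \<Upsilon>2 \<and>
       f \<in> H52_boundary \<Omega> \<and> SPN_solution \<Omega> g N \<sigma>a \<sigma>s f \<Phi>"
  then have adm: "admissible \<Omega> c_lo c_hi M0 \<sigma>a \<sigma>s \<Upsilon>1" "admissible \<Omega> c_lo c_hi M0 \<sigma>a \<sigma>s \<Upsilon>2"
    and sol: "SPN_solution \<Omega> g N \<sigma>a \<sigma>s f \<Phi>" by auto
  define m where "m = (N + 1) div 2"
  define w where "w x = scalar_prod (s_row m 1) (vec1 m (\<lambda>n. \<Phi> n x))" for x
  have \<sigma>a: "c_lo \<le> \<sigma>a x" "\<sigma>a x \<le> c_hi" if "x \<in> \<Omega>" for x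
    using adm(1) closure_subset that by (auto simp: admissible_def)
  have \<Upsilon>: "\<Upsilon>1 \<in> borel_measurable (lebesgue_on \<Omega>)" "\<Upsilon>2 \<in> borel_measurable (lebesgue_on \<Omega>)"
    "AE x in lebesgue_on \<Omega>. c_lo \<le> \<Upsilon>1 x \<and> \<Upsilon>1 x \<le> c_hi"
    "AE x in lebesgue_on \<Omega>. c_lo \<le> \<Upsilon>2 x \<and> \<Upsilon>2 x \<le> c_hi"
    using adm by (auto simp: admissible_def)
  have "\<Phi> n \<in> L2 (lebesgue_on \<Omega>)" if "n \<in> {1..m}" for n
    using sol that by (auto simp: SPN_solution_def Let_def m_def Sobolev_H1_def)
  \<comment> \<open>The scalar product s_1 . \<Phi> written out: library vectors count from 0, the
    components of \<Phi> from 1, hence \<open>Suc i\<close>.\<close>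
  then have "(\<lambda>x. \<Sum>i\<in>{0..<m}. vec_index (s_row m 1) i * \<Phi> (Suc i) x) \<in> L2 (lebesgue_on \<Omega>)"
    by (intro L2_sum_mult) auto
  then have "w \<in> L2 (lebesgue_on \<Omega>)"
    by (simp add: w_def [abs_def] scalar_prod_def vec1_def)
  \<comment> \<open>Both values lie in [\<open>c_lo\<close>, \<open>c_hi\<close>] with
    \<open>c_lo\<close> > 0, so they differ by at most \<open>c_hi\<close>.\<close>
  moreover have "AE x in lebesgue_on \<Omega>. \<bar>\<Upsilon>1 x - \<Upsilon>2 x\<bar> \<le> c_hi"
    using \<Upsilon>(3,4) by eventually_elim (use assms in auto)
  ultimately have v: "(\<lambda>x. (\<Upsilon>1 x - \<Upsilon>2 x) * w x) \<in> L2 (lebesgue_on \<Omega>)"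
    using \<Upsilon>(1,2) by (intro L2_bounded_mult) auto
  have H: "internal_datum N \<Upsilon> \<sigma>a \<Phi> x = \<Upsilon> x * \<sigma>a x * w x" for \<Upsilon> x
    by (simp add: internal_datum_def Let_def m_def w_def)
  have "L2_norm (lebesgue_on \<Omega>) (\<lambda>x. (\<Upsilon>1 x - \<Upsilon>2 x) * (\<Upsilon>1 x * \<sigma>a x * w x / \<Upsilon>1 x))
      \<le> c_hi * L2_norm (lebesgue_on \<Omega>) (\<lambda>x. (\<Upsilon>1 x - \<Upsilon>2 x) * w x)"
  proof (rule L2_norm_le_mult[OF v])
    show "AE x in lebesgue_on \<Omega>. \<bar>(\<Upsilon>1 x - \<Upsilon>2 x) * (\<Upsilon>1 x * \<sigma>a x * w x / \<Upsilon>1 x)\<bar>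
        \<le> c_hi * \<bar>(\<Upsilon>1 x - \<Upsilon>2 x) * w x\<bar>"
      \<comment> \<open>The bounds on \<Upsilon>_1 hold only almost everywhere, those on \<sigma>a
        at every point of \<Omega>; \<open>AE_space\<close> supplies that \<open>x\<close> lies in
        \<Omega>. Positivity of \<Upsilon>_1 lets it cancel.\<close>
      using \<Upsilon>(3) AE_space
    proof eventually_elim
      case (elim x)
      then have "x \<in> \<Omega>" "\<Upsilon>1 x \<noteq> 0" using assms by auto
      then have "\<bar>(\<Upsilon>1 x - \<Upsilon>2 x) * (\<Upsilon>1 x * \<sigma>a x * w x / \<Upsilon>1 x)\<bar> = \<sigma>a x * \<bar>(\<Upsilon>1 x - \<Upsilon>2 x) * w x\<bar>"
        using \<sigma>a(1)[of x] \<open>0 < c_lo\<close> by (simp add: abs_mult)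
      also have "\<dots> \<le> c_hi * \<bar>(\<Upsilon>1 x - \<Upsilon>2 x) * w x\<bar>"
        by (rule mult_right_mono[OF \<sigma>a(2)]) (use \<open>x \<in> \<Omega>\<close> in auto)
      finally show ?case .
    qed
  qed (use assms in linarith)
  \<comment> \<open>Here only \<sigma>a is cancelled, and it is positive on all of \<Omega>, so the
    integrands agree at every point.\<close>
  also have "L2_norm (lebesgue_on \<Omega>) (\<lambda>x. (\<Upsilon>1 x - \<Upsilon>2 x) * w x) =
      L2_norm (lebesgue_on \<Omega>) (\<lambda>x. (\<Upsilon>1 x * \<sigma>a x * w x - \<Upsilon>2 x * \<sigma>a x * w x) / \<sigma>a x)"
    unfolding L2_norm_def
  proof (intro arg_cong[where f = sqrt] Bochner_Integration.integral_cong refl)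
    fix x assume "x \<in> space (lebesgue_on \<Omega>)"
    then have "\<sigma>a x \<noteq> 0" using \<sigma>a(1)[of x] \<open>0 < c_lo\<close> by auto
    then show "((\<Upsilon>1 x - \<Upsilon>2 x) * w x)\<^sup>2 = ((\<Upsilon>1 x * \<sigma>a x * w x - \<Upsilon>2 x * \<sigma>a x * w x) / \<sigma>a x)\<^sup>2"
      by (intro arg_cong[where f = "\<lambda>t. t\<^sup>2"]) (simp add: field_simps)
  qed
  finally show "let H1 = internal_datum N \<Upsilon>1 \<sigma>a \<Phi>; H2 = internal_datum N \<Upsilon>2 \<sigma>a \<Phi> in
          L2_norm (lebesgue_on \<Omega>) (\<lambda>x. (\<Upsilon>1 x - \<Upsilon>2 x) * (H1 x / \<Upsilon>1 x))
          \<le> c_hi * L2_norm (lebesgue_on \<Omega>) (\<lambda>x. (H1 x - H2 x) / \<sigma>a x)"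
    by (simp only: Let_def H)
qed

end
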